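(* Let $G = G_2(\alpha,\beta,\epsilon,\delta,-)$ be a metacyclic $2$-group of negative type, with generators $x,y$ as in its presentation, and suppose $\delta\ge 1$. Let $N=\langle x^{2^{\alpha-\delta+1}}\rangle$. Then $\eta(G)=\eta(G/N)$.
   Context: For a finite group $G$, a maximal cyclic subgroup is a cyclic subgroup not properly contained in any other cyclic subgroup, and $\eta(G)$ is the number of conjugacy classes of maximal cyclic subgroups of $G$. Write $x^y = y^{-1}xy$. For integers $\alpha,\beta>0$, $\delta\ge 0$, $\epsilon\in\{0,1\}$ with $\delta\le\beta$, $\alpha-\delta\ge 2$ and $\delta+\epsilon\le\alpha$, the metacyclic $2$-group of negative type is $$G_2(\alpha,\beta,\epsilon,\delta,-)=\langle x,y \mid x^{2^\alpha}=1,\ y^{2^\beta}=x^{2^{\alpha-\epsilon}},\ x^y=x^{r}\rangle,\quad r=2^{\alpha-\delta}-1.$$ It has order $2^{\alpha+\beta}$, and $\langle x\rangle$ is normal of order $2^\alpha$. *)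

theory Defs
  imports "HOL-Algebra.Algebra"
begin

section \<open>Groups given by generators and relations\<close>

text \<open>
  A letter \<open>(g, True)\<close> stands for the generator \<open>g\<close>, a letter \<open>(g, False)\<close> for its formal inverse.
  A pair \<open>(u, v)\<close> of words in a set of relations stands for the relation \<open>u = v\<close>.
\<close>

type_synonym 'g word = "('g \<times> bool) list"

inductive pres_eq :: "('g word \<times> 'g word) set \<Rightarrow> 'g word \<Rightarrow> 'g word \<Rightarrow> bool" for R where
  relation: "(u, v) \<in> R \<Longrightarrow> pres_eq R u v"
| cancel: "pres_eq R [(g, b), (g, \<not> b)] []"
| refl: "pres_eq R u u"
| sym: "pres_eq R u v \<Longrightarrow> pres_eq R v u"
| trans: "pres_eq R u v \<Longrightarrow> pres_eq R v w \<Longrightarrow> pres_eq R u w"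
| append: "pres_eq R u u' \<Longrightarrow> pres_eq R v v' \<Longrightarrow> pres_eq R (u @ v) (u' @ v')"

definition word_class :: "('g word \<times> 'g word) set \<Rightarrow> 'g word \<Rightarrow> 'g word set" where
  "word_class R u = {v. pres_eq R u v}"

definition presented_group :: "('g word \<times> 'g word) set \<Rightarrow> 'g word set monoid" where
  "presented_group R =
     \<lparr>carrier = range (word_class R),
      monoid.mult = (\<lambda>A B. \<Union>u\<in>A. \<Union>v\<in>B. word_class R (u @ v)),
      monoid.one = word_class R []\<rparr>"

lemma word_class_eq_iff: "word_class R u = word_class R v \<longleftrightarrow> pres_eq R u v"
  unfolding word_class_def set_eq_iff mem_Collect_eq
  by (meson pres_eq.refl pres_eq.sym pres_eq.trans)

lemma presented_group_mult:
  "word_class R u \<otimes>\<^bsub>presented_group R\<^esub> word_class R v = word_class R (u @ v)"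
proof -
  have "word_class R (u' @ v') = word_class R (u @ v)"
    if "u' \<in> word_class R u" "v' \<in> word_class R v" for u' v'
  proof -
    have "pres_eq R u u'" "pres_eq R v v'" using that by (simp_all add: word_class_def)
    then have "pres_eq R (u' @ v') (u @ v)" by (intro pres_eq.sym[OF pres_eq.append])
    then show ?thesis by (simp only: word_class_eq_iff)
  qed
  moreover have "u \<in> word_class R u" "v \<in> word_class R v"
    by (simp_all add: word_class_def pres_eq.refl)
  ultimately have "(\<Union>u'\<in>word_class R u. \<Union>v'\<in>word_class R v. word_class R (u' @ v'))
      = word_class R (u @ v)"
    by blast
  then show ?thesis
    by (simp add: presented_group_def)
qed

lemma pres_eq_left_inverse: "pres_eq R (rev (map (\<lambda>(g, b). (g, \<not> b)) u) @ u) []"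
proof (induction u)
  case Nil
  show ?case by (simp add: pres_eq.refl)
next
  case (Cons a u)
  obtain g b where a: "a = (g, b)" by fastforce
  let ?w = "rev (map (\<lambda>(g, b). (g, \<not> b)) u)"
  have "pres_eq R ([(g, \<not> b), (g, b)] @ u) ([] @ u)"
    using pres_eq.cancel[of R g "\<not> b"] by (intro pres_eq.append pres_eq.refl) simp
  then have "pres_eq R (?w @ [(g, \<not> b), (g, b)] @ u) (?w @ u)"
    by (intro pres_eq.append pres_eq.refl) simp
  from pres_eq.trans[OF this Cons.IH] show ?case
    using a by simp
qed

lemma group_presented_group: "group (presented_group R)"
proof (rule groupI)
  fix A assume "A \<in> carrier (presented_group R)"
  then obtain u where "A = word_class R u" by (auto simp: presented_group_def)
  then have "word_class R (rev (map (\<lambda>(g, b). (g, \<not> b)) u)) \<otimes>\<^bsub>presented_group R\<^esub> A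
      = \<one>\<^bsub>presented_group R\<^esub>"
    by (simp only: presented_group_mult)
      (simp add: presented_group_def word_class_eq_iff pres_eq_left_inverse)
  then show "\<exists>B\<in>carrier (presented_group R).
      B \<otimes>\<^bsub>presented_group R\<^esub> A = \<one>\<^bsub>presented_group R\<^esub>"
    by (auto simp: presented_group_def)
next
  fix A B assume "A \<in> carrier (presented_group R)" "B \<in> carrier (presented_group R)"
  then obtain u v where "A = word_class R u" "B = word_class R v"
    by (auto simp: presented_group_def)
  then show "A \<otimes>\<^bsub>presented_group R\<^esub> B \<in> carrier (presented_group R)"
    by (simp only: presented_group_mult) (simp add: presented_group_def)
next
  show "\<one>\<^bsub>presented_group R\<^esub> \<in> carrier (presented_group R)"
    by (simp add: presented_group_def)
next
  fix A B C assume "A \<in> carrier (presented_group R)" "B \<in> carrier (presented_group R)"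
    "C \<in> carrier (presented_group R)"
  then obtain u v w where "A = word_class R u" "B = word_class R v" "C = word_class R w"
    by (auto simp: presented_group_def)
  then show "A \<otimes>\<^bsub>presented_group R\<^esub> B \<otimes>\<^bsub>presented_group R\<^esub> C
      = A \<otimes>\<^bsub>presented_group R\<^esub> (B \<otimes>\<^bsub>presented_group R\<^esub> C)"
    by (simp add: presented_group_mult)
next
  fix A assume "A \<in> carrier (presented_group R)"
  then obtain u where u: "A = word_class R u" by (auto simp: presented_group_def)
  have "\<one>\<^bsub>presented_group R\<^esub> = word_class R []" by (simp add: presented_group_def)
  then show "\<one>\<^bsub>presented_group R\<^esub> \<otimes>\<^bsub>presented_group R\<^esub> A = A"
    using u by (simp add: presented_group_mult)
qed

section \<open>Metacyclic 2-groups of negative type\<close>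

datatype gen = gen_x | gen_y

abbreviation gen_pow :: "'g \<Rightarrow> nat \<Rightarrow> 'g word" where
  "gen_pow g n \<equiv> replicate n (g, True)"

text \<open>The third relation is \<open>y\<inverse> x y = x\<^sup>r\<close> with \<open>r = 2\<^bsup>\<alpha> - \<delta>\<^esup> - 1\<close>.\<close>

definition G2_neg_relations :: "nat \<Rightarrow> nat \<Rightarrow> nat \<Rightarrow> nat \<Rightarrow> (gen word \<times> gen word) set" where
  "G2_neg_relations \<alpha> \<beta> \<epsilon> \<delta> =
     {(gen_pow gen_x (2 ^ \<alpha>), []),
      (gen_pow gen_y (2 ^ \<beta>), gen_pow gen_x (2 ^ (\<alpha> - \<epsilon>))),
      ([(gen_y, False), (gen_x, True), (gen_y, True)], gen_pow gen_x (2 ^ (\<alpha> - \<delta>) - 1))}"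

definition G2_neg :: "nat \<Rightarrow> nat \<Rightarrow> nat \<Rightarrow> nat \<Rightarrow> gen word set monoid" where
  "G2_neg \<alpha> \<beta> \<epsilon> \<delta> = presented_group (G2_neg_relations \<alpha> \<beta> \<epsilon> \<delta>)"

text \<open>
  \<open>is_G2_neg G x y \<alpha> \<beta> \<epsilon> \<delta>\<close>: the group \<open>G\<close> is a copy of \<open>G\<^sub>2(\<alpha>, \<beta>, \<epsilon>, \<delta>, -)\<close>, in which \<open>x\<close> and \<open>y\<close>
  are the generators of the presentation.
\<close>

definition is_G2_neg ::
    "('a, 'b) monoid_scheme \<Rightarrow> 'a \<Rightarrow> 'a \<Rightarrow> nat \<Rightarrow> nat \<Rightarrow> nat \<Rightarrow> nat \<Rightarrow> bool" where
  "is_G2_neg G x y \<alpha> \<beta> \<epsilon> \<delta> \<longleftrightarrow>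
     group G \<and>
     (\<exists>h \<in> iso (G2_neg \<alpha> \<beta> \<epsilon> \<delta>) G.
        h (word_class (G2_neg_relations \<alpha> \<beta> \<epsilon> \<delta>) [(gen_x, True)]) = x \<and>
        h (word_class (G2_neg_relations \<alpha> \<beta> \<epsilon> \<delta>) [(gen_y, True)]) = y)"

lemma is_G2_neg_G2_neg:
  "is_G2_neg (G2_neg \<alpha> \<beta> \<epsilon> \<delta>) (word_class (G2_neg_relations \<alpha> \<beta> \<epsilon> \<delta>) [(gen_x, True)])
     (word_class (G2_neg_relations \<alpha> \<beta> \<epsilon> \<delta>) [(gen_y, True)]) \<alpha> \<beta> \<epsilon> \<delta>"
proof -
  have "(\<lambda>A. A) \<in> iso (G2_neg \<alpha> \<beta> \<epsilon> \<delta>) (G2_neg \<alpha> \<beta> \<epsilon> \<delta>)"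
    using iso_set_refl by blast
  moreover have "group (G2_neg \<alpha> \<beta> \<epsilon> \<delta>)"
    by (simp add: G2_neg_def group_presented_group)
  ultimately show ?thesis
    unfolding is_G2_neg_def by (intro conjI bexI[of _ "\<lambda>A. A"] HOL.refl)
qed

section \<open>Conjugacy classes of maximal cyclic subgroups\<close>

definition cyclic_subgroup :: "'a set \<Rightarrow> ('a, 'b) monoid_scheme \<Rightarrow> bool" where
  "cyclic_subgroup H G \<longleftrightarrow> subgroup H G \<and> cyclic_group (G\<lparr>carrier := H\<rparr>)"

lemma (in group) cyclic_subgroup_iff:
  "cyclic_subgroup H G \<longleftrightarrow> (\<exists>g\<in>carrier G. H = generate G {g})"
proof
  assume "cyclic_subgroup H G"
  then have H: "subgroup H G" and "cyclic_group (G\<lparr>carrier := H\<rparr>)"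
    by (auto simp: cyclic_subgroup_def)
  then obtain g where g: "g \<in> H" "subgroup_generated (G\<lparr>carrier := H\<rparr>) {g} = G\<lparr>carrier := H\<rparr>"
    by (auto simp: cyclic_group_def)
  then have "generate (G\<lparr>carrier := H\<rparr>) {g} = H"
    by (metis carrier_subgroup_generated inf.absorb2 partial_object.select_convs(1)
        partial_object.surjective partial_object.update_convs(1) singletonD subsetI)
  then have "generate G {g} = H"
    using generate_consistent[of "{g}" H] g(1) H by simp
  then show "\<exists>g\<in>carrier G. H = generate G {g}"
    using g(1) subgroup.mem_carrier[OF H] by blast
next
  assume "\<exists>g\<in>carrier G. H = generate G {g}"
  then obtain g where g: "g \<in> carrier G" "H = generate G {g}" by blast
  then have "G\<lparr>carrier := H\<rparr> = subgroup_generated G {g}"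
    by (simp add: subgroup_generated_def)
  then show "cyclic_subgroup H G"
    using g generate_is_subgroup[of "{g}"] cyclic_group_generated[of g]
    by (simp add: cyclic_subgroup_def)
qed

definition maximal_cyclic_subgroups :: "('a, 'b) monoid_scheme \<Rightarrow> 'a set set" where
  "maximal_cyclic_subgroups G =
     {H. cyclic_subgroup H G \<and> \<not> (\<exists>K. cyclic_subgroup K G \<and> H \<subset> K)}"

text \<open>
  Only meaningful when there are finitely many classes, in particular for finite \<open>G\<close>.
  Conjugation by \<open>g\<close> is \<open>H \<mapsto> g H g\<inverse>\<close>, as in the library; the
  convention \<open>H \<mapsto> g\<inverse> H g\<close> has the same orbits.
\<close>

definition eta :: "('a, 'b) monoid_scheme \<Rightarrow> nat" where
  "eta G = card (orbits G (maximal_cyclic_subgroups G) (\<lambda>g H. g <#\<^bsub>G\<^esub> H #>\<^bsub>G\<^esub> inv\<^bsub>G\<^esub> g))"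

end

theory Submission
  imports Defs "HOL-Number_Theory.Cong"
begin

text \<open>
  Write \<open>m = \<alpha> - \<delta>\<close>, so that \<open>r = 2\<^sup>m - 1\<close> and \<open>N\<close> is generated by \<open>x\<close> to the power \<open>2\<^bsup>m+1\<^esup>\<close>. The point
  is that passing to \<open>G/N\<close> merges nothing that conjugation has not merged already: if \<open>g\<close> generates a
  maximal cyclic subgroup of \<open>G\<close>, then every element of \<open>gN\<close> is a conjugate of \<open>g\<close>
  (\<open>coset_conjugate_if_maximal_cyclic\<close>).

  For a finite group and an epimorphism whose fibres have this property, \<open>\<eta>\<close> does not change
  (\<open>eta_eq_if_fibres_conjugate\<close>). Suppose \<open>\<langle>g\<rangle>\<close> is maximal cyclic and its image is contained in the
  image of \<open>\<langle>h\<rangle>\<close>. Some power of \<open>h\<close> has the same image as \<open>g\<close>, hence is conjugate to \<open>g\<close>, and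
  maximality forces \<open>\<langle>h\<rangle>\<close> itself to be conjugate to \<open>\<langle>g\<rangle>\<close>. This one observation shows that images of
  maximal cyclic subgroups are maximal cyclic and that two of them are conjugate only if the original
  subgroups are.

  To see that the fibres have the property, write \<open>g = y\<^sup>b x\<^sup>a\<close> and use that
  \<open>r\<^sup>2 = 1 + 2\<^bsup>m+1\<^esup> u\<close> with \<open>u\<close> odd. There are three cases.

  \<^item> If \<open>4\<close> does not divide \<open>b\<close>, then \<open>1 - r\<^sup>b\<close> is divisible by no higher power of two than \<open>2\<^bsup>m+1\<^esup>\<close>.
    Conjugating \<open>g\<close> by \<open>x\<^sup>k\<close> multiplies it by \<open>x\<close> to the power \<open>k (1 - r\<^sup>b)\<close>, and these powers
    cover \<open>N\<close> (\<open>conjugate_by_x\<close>).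

  \<^item> If \<open>a\<close> is odd, conjugating \<open>g\<close> by \<open>y\<^bsup>2i\<^esup>\<close> replaces \<open>a\<close> by \<open>a r\<^bsup>2i\<^esup>\<close>. As the powers of \<open>r\<^sup>2\<close> are
    all the residues modulo \<open>2\<^sup>\<alpha>\<close> that are congruent to \<open>1\<close> modulo \<open>2\<^bsup>m+1\<^esup>\<close>, these elements cover \<open>gN\<close> (\<open>conjugate_by_y\<close>).

  \<^item> If \<open>4\<close> divides \<open>b\<close> and \<open>a\<close> is even, then \<open>g\<close> is the square of some \<open>y\<^bsup>b/2\<^esup> x\<^sup>k\<close>
    (\<open>square_if_four_dvd_even\<close>), and in a nontrivial 2-group a square never generates a maximal cyclic
    subgroup.
\<close>


section \<open>Counting classes of maximal cyclic subgroups along an epimorphism\<close>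

text \<open>
  The same set as \<open>z <# H #> inv z\<close>, written as the image under an inner automorphism so that
  facts about homomorphisms apply to it.
\<close>

definition conjugate :: "('a, 'b) monoid_scheme \<Rightarrow> 'a \<Rightarrow> 'a set \<Rightarrow> 'a set" where
  "conjugate G z H = (\<lambda>h. z \<otimes>\<^bsub>G\<^esub> h \<otimes>\<^bsub>G\<^esub> inv\<^bsub>G\<^esub> z) ` H"

lemma eta_eq_card_orbits:
  "eta G = card (orbit G (conjugate G) ` maximal_cyclic_subgroups G)"
proof -
  have "(\<lambda>g H. g <#\<^bsub>G\<^esub> H #>\<^bsub>G\<^esub> inv\<^bsub>G\<^esub> g) = conjugate G"
    by (intro ext) (auto simp: conjugate_def l_coset_def r_coset_def)
  then show ?thesis by (simp add: eta_def orbits_def Setcompr_eq_image)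
qed

lemma (in group) conjugation_hom:
  assumes "z \<in> carrier G"
  shows "(\<lambda>h. z \<otimes> h \<otimes> inv z) \<in> hom G G"
proof (rule homI)
  fix a b assume "a \<in> carrier G" "b \<in> carrier G"
  moreover have "inv z \<otimes> (z \<otimes> c) = c" if "c \<in> carrier G" for c
    using assms that by (simp flip: m_assoc)
  ultimately show "z \<otimes> (a \<otimes> b) \<otimes> inv z = z \<otimes> a \<otimes> inv z \<otimes> (z \<otimes> b \<otimes> inv z)"
    using assms by (simp add: m_assoc)
qed (use assms in simp)

lemma (in group) conjugate_generate:
  assumes "z \<in> carrier G" "g \<in> carrier G"
  shows "conjugate G z (generate G {g}) = generate G {z \<otimes> g \<otimes> inv z}"
proof -
  interpret c: group_hom G G "\<lambda>h. z \<otimes> h \<otimes> inv z"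
    by unfold_locales (rule conjugation_hom[OF assms(1)])
  show ?thesis
    using c.generate_img[of "{g}"] assms by (simp add: conjugate_def)
qed

lemma (in group) conjugate_conjugate:
  assumes "z \<in> carrier G" "w \<in> carrier G" "H \<subseteq> carrier G"
  shows "conjugate G z (conjugate G w H) = conjugate G (z \<otimes> w) H"
  unfolding conjugate_def image_image
  by (rule image_cong) (use assms in \<open>auto simp: m_assoc inv_mult_group subset_iff\<close>)

lemma (in group) conjugate_one:
  assumes "H \<subseteq> carrier G"
  shows "conjugate G \<one> H = H"
proof -
  have "(\<lambda>h. \<one> \<otimes> h \<otimes> inv \<one>) ` H = (\<lambda>h. h) ` H"
    by (rule image_cong) (use assms in auto)
  then show ?thesis unfolding conjugate_def by simp
qed

lemma (in group) conjugate_inverse: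
  assumes "z \<in> carrier G" "H \<subseteq> carrier G"
  shows "conjugate G (inv z) (conjugate G z H) = H"
  using conjugate_conjugate[of "inv z" z H] conjugate_one assms by simp

lemma (in group) orbit_conjugate_eq_iff:
  assumes "H \<subseteq> carrier G" "K \<subseteq> carrier G"
  shows "orbit G (conjugate G) H = orbit G (conjugate G) K
    \<longleftrightarrow> (\<exists>z\<in>carrier G. K = conjugate G z H)" (is "?O H = ?O K \<longleftrightarrow> ?conj")
proof
  assume "?O H = ?O K"
  moreover have "K \<in> ?O K"
    using conjugate_one[OF assms(2)] one_closed unfolding orbit_def by force
  ultimately have "K \<in> ?O H" by simp
  then show ?conj by (auto simp: orbit_def)
next
  assume ?conj
  then obtain z where z: "z \<in> carrier G" "K = conjugate G z H" by blast
  have le: "?O (conjugate G z H) \<subseteq> ?O H" if "H \<subseteq> carrier G" "z \<in> carrier G" for z H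
  proof
    fix L assume "L \<in> ?O (conjugate G z H)"
    then obtain w where "w \<in> carrier G" "L = conjugate G w (conjugate G z H)"
      by (auto simp: orbit_def)
    then show "L \<in> ?O H"
      using that conjugate_conjugate[of w z H] m_closed unfolding orbit_def by blast
  qed
  have "H = conjugate G (inv z) K"
    using conjugate_inverse z assms by simp
  then show "?O H = ?O K"
    using le[OF assms(2), of "inv z"] le[OF assms(1) z(1)] z by auto
qed

lemma (in group) cyclic_subgroupE:
  assumes "cyclic_subgroup H G"
  obtains g where "g \<in> carrier G" "H = generate G {g}"
  using assms cyclic_subgroup_iff by auto

lemma (in group) cyclic_subgroup_generate:
  "g \<in> carrier G \<Longrightarrow> cyclic_subgroup (generate G {g}) G"
  using cyclic_subgroup_iff by auto

lemma (in group) generate_singleton_subset: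
  assumes "h \<in> carrier G" "g \<in> generate G {h}"
  shows "generate G {g} \<subseteq> generate G {h}"
  using generate_subgroup_incl[of "{g}"] generate_is_subgroup[of "{h}"] assms by simp

lemma maximal_cyclic_eq:
  assumes "H \<in> maximal_cyclic_subgroups G" "cyclic_subgroup K G" "H \<subseteq> K"
  shows "K = H"
  using assms unfolding maximal_cyclic_subgroups_def by blast

lemma (in group) cyclic_le_maximal_cyclic:
  assumes "finite (carrier G)" "cyclic_subgroup H G"
  obtains M where "M \<in> maximal_cyclic_subgroups G" "H \<subseteq> M"
proof -
  have "{K. cyclic_subgroup K G} \<subseteq> Pow (carrier G)"
    using subgroup.subset by (auto simp: cyclic_subgroup_def)
  then have "finite {K. cyclic_subgroup K G}"
    using assms(1) by (meson finite_Pow_iff finite_subset)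
  then obtain M where "cyclic_subgroup M G" "H \<subseteq> M"
      "\<And>K. cyclic_subgroup K G \<Longrightarrow> M \<subseteq> K \<Longrightarrow> M = K"
    using finite_has_maximal2[of "{K. cyclic_subgroup K G}" H] assms(2) by auto
  then show thesis
    using that[of M] unfolding maximal_cyclic_subgroups_def by blast
qed

text \<open>
  Here \<open>p\<close> and \<open>q\<close> send an element to its class. The map \<open>F\<close> induces a bijection of
  classes, even where it identifies elements.
\<close>

lemma card_image_eq_via:
  assumes "\<And>a b. a \<in> A \<Longrightarrow> b \<in> A \<Longrightarrow> p a = p b \<longleftrightarrow> q (F a) = q (F b)"
    and "F ` A = B"
  shows "card (p ` A) = card (q ` B)"
proof -
  define u where "u = (\<lambda>c. q (F (SOME a. a \<in> A \<and> p a = c)))"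
  have u: "u (p a) = q (F a)" if "a \<in> A" for a
  proof -
    have "(SOME b. b \<in> A \<and> p b = p a) \<in> A \<and> p (SOME b. b \<in> A \<and> p b = p a) = p a"
      by (rule someI[of _ a]) (use that in simp)
    then show ?thesis using assms(1) that unfolding u_def by blast
  qed
  have "inj_on u (p ` A)"
    by (rule inj_onI) (use u assms(1) in auto)
  moreover have "u ` (p ` A) = q ` B"
    using u assms(2) by (force simp: image_image)
  ultimately show ?thesis using card_image by metis
qed

text \<open>
  Taking images under \<open>f\<close> maps maximal cyclic subgroups of \<open>G\<close> onto those of \<open>Q\<close> and induces a
  bijection of conjugacy classes. Both facts come from comparing \<open>\<langle>g\<rangle>\<close> with a cyclic subgroup \<open>\<langle>h\<rangle>\<close> whose
  image contains that of \<open>\<langle>g\<rangle>\<close>: the fibre condition moves a generator of \<open>\<langle>g\<rangle>\<close> into \<open>\<langle>h\<rangle>\<close> by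
  conjugation.
\<close>

theorem eta_eq_if_fibres_conjugate:
  fixes G :: "('a, 'b) monoid_scheme" and Q :: "('c, 'd) monoid_scheme"
  assumes "group_hom G Q f" and fin: "finite (carrier G)" and surj: "f ` carrier G = carrier Q"
    and fibre: "\<And>g h. g \<in> carrier G \<Longrightarrow> generate G {g} \<in> maximal_cyclic_subgroups G \<Longrightarrow>
        h \<in> carrier G \<Longrightarrow> f h = f g \<Longrightarrow> \<exists>z\<in>carrier G. h = z \<otimes>\<^bsub>G\<^esub> g \<otimes>\<^bsub>G\<^esub> inv\<^bsub>G\<^esub> z"
  shows "eta G = eta Q"
proof -
  interpret group_hom G Q f by fact
  have img: "f ` generate G {g} = generate Q {f g}" if "g \<in> carrier G" for g
    using generate_img[of "{g}"] that by simp
  have sub: "generate G {g} \<subseteq> carrier G" if "g \<in> carrier G" for g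
    using G.generate_incl[of "{g}"] that by simp
  have equivar: "f ` conjugate G z A = conjugate Q (f z) (f ` A)"
    if "z \<in> carrier G" "A \<subseteq> carrier G" for z A
    unfolding conjugate_def image_image
    by (rule image_cong) (use that in \<open>auto simp: subset_iff\<close>)
  \<comment> \<open>An element of \<open>\<langle>h\<rangle>\<close> over \<open>f g\<close> is a conjugate of \<open>g\<close>; undoing that conjugation puts \<open>\<langle>g\<rangle>\<close> inside
    a conjugate of \<open>\<langle>h\<rangle>\<close>, where maximality applies.\<close>
  have key: "\<exists>z\<in>carrier G. generate G {h} = conjugate G z (generate G {g})"
    if g: "g \<in> carrier G" and max: "generate G {g} \<in> maximal_cyclic_subgroups G"
      and h: "h \<in> carrier G" and le: "f ` generate G {g} \<subseteq> f ` generate G {h}" for g h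
  proof -
    have "f g \<in> f ` generate G {h}"
      using le generate.incl[of g "{g}" G] by auto
    then obtain p where p: "p \<in> generate G {h}" "f p = f g" by auto
    then have pc: "p \<in> carrier G" using sub h by blast
    obtain z where z: "z \<in> carrier G" "p = z \<otimes>\<^bsub>G\<^esub> g \<otimes>\<^bsub>G\<^esub> inv\<^bsub>G\<^esub> z"
      using fibre[OF g max pc p(2)] by blast
    have "conjugate G z (generate G {g}) \<subseteq> generate G {h}"
      using G.conjugate_generate z g G.generate_singleton_subset[OF h p(1)] by simp
    then have "conjugate G (inv\<^bsub>G\<^esub> z) (conjugate G z (generate G {g}))
        \<subseteq> conjugate G (inv\<^bsub>G\<^esub> z) (generate G {h})"
      unfolding conjugate_def by (rule image_mono)
    then have "generate G {g} \<subseteq> conjugate G (inv\<^bsub>G\<^esub> z) (generate G {h})"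
      using G.conjugate_inverse[OF z(1) sub[OF g]] by simp
    moreover have "cyclic_subgroup (conjugate G (inv\<^bsub>G\<^esub> z) (generate G {h})) G"
      using G.conjugate_generate[of "inv\<^bsub>G\<^esub> z" h] z(1) h G.cyclic_subgroup_generate by simp
    ultimately have "generate G {g} = conjugate G (inv\<^bsub>G\<^esub> z) (generate G {h})"
      using maximal_cyclic_eq[OF max] by blast
    then have "generate G {h} = conjugate G z (generate G {g})"
      using G.conjugate_inverse[of "inv\<^bsub>G\<^esub> z" "generate G {h}"] sub h z(1) by simp
    then show ?thesis using z(1) by blast
  qed
  have maxE: "\<exists>g\<in>carrier G. A = generate G {g}" if "A \<in> maximal_cyclic_subgroups G" for A
    using that G.cyclic_subgroup_iff by (auto simp: maximal_cyclic_subgroups_def)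
  have image_max: "f ` A \<in> maximal_cyclic_subgroups Q" if A: "A \<in> maximal_cyclic_subgroups G" for A
  proof -
    obtain g where g: "g \<in> carrier G" "A = generate G {g}" using maxE[OF A] by blast
    have "K = f ` A" if K: "cyclic_subgroup K Q" "f ` A \<subseteq> K" for K
    proof -
      obtain k where k: "k \<in> carrier Q" "K = generate Q {k}" using H.cyclic_subgroupE[OF K(1)] .
      obtain h where h: "h \<in> carrier G" "k = f h" using k(1) surj by auto
      have Kh: "K = f ` generate G {h}" using img h k by simp
      obtain z where z: "z \<in> carrier G" "generate G {h} = conjugate G z A"
        using key[OF g(1) _ h(1)] A g(2) K(2) Kh by auto
      \<comment> \<open>Conjugate subgroups have equally many elements, so the inclusion is an equality.\<close>
      have "K = (\<lambda>a. f z \<otimes>\<^bsub>Q\<^esub> a \<otimes>\<^bsub>Q\<^esub> inv\<^bsub>Q\<^esub> f z) ` (f ` A)"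
        using equivar[OF z(1)] sub[OF g(1)] g(2) Kh z(2) conjugate_def by simp
      moreover have finA: "finite (f ` A)"
        using sub[OF g(1)] g(2) fin finite_subset by auto
      ultimately have "finite K" "card K \<le> card (f ` A)"
        by (simp_all add: card_image_le)
      then show ?thesis using K(2) card_seteq by metis
    qed
    moreover have "cyclic_subgroup (f ` A) Q"
      using img g H.cyclic_subgroup_generate by simp
    ultimately show ?thesis unfolding maximal_cyclic_subgroups_def by blast
  qed
  have onto: "(`) f ` maximal_cyclic_subgroups G = maximal_cyclic_subgroups Q"
  proof
    show "(`) f ` maximal_cyclic_subgroups G \<subseteq> maximal_cyclic_subgroups Q"
      using image_max by auto
    show "maximal_cyclic_subgroups Q \<subseteq> (`) f ` maximal_cyclic_subgroups G"
    proof
      fix B assume B: "B \<in> maximal_cyclic_subgroups Q"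
      then obtain k where k: "k \<in> carrier Q" "B = generate Q {k}"
        using H.cyclic_subgroup_iff by (auto simp: maximal_cyclic_subgroups_def)
      obtain h where h: "h \<in> carrier G" "k = f h" using k(1) surj by auto
      obtain M where M: "M \<in> maximal_cyclic_subgroups G" "generate G {h} \<subseteq> M"
        using G.cyclic_le_maximal_cyclic[OF fin G.cyclic_subgroup_generate[OF h(1)]] .
      have "B \<subseteq> f ` M" using image_mono[OF M(2), of f] img[OF h(1)] h(2) k(2) by simp
      moreover have "cyclic_subgroup (f ` M) Q"
        using image_max[OF M(1)] by (simp add: maximal_cyclic_subgroups_def)
      ultimately have "f ` M = B" using maximal_cyclic_eq[OF B] by simp
      then show "B \<in> (`) f ` maximal_cyclic_subgroups G" using M(1) by blast
    qed
  qed
  have orbits_iff: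
    "orbit G (conjugate G) A = orbit G (conjugate G) B
    \<longleftrightarrow> orbit Q (conjugate Q) (f ` A) = orbit Q (conjugate Q) (f ` B)"
    if A: "A \<in> maximal_cyclic_subgroups G" and B: "B \<in> maximal_cyclic_subgroups G" for A B
  proof -
    obtain a where a: "a \<in> carrier G" "A = generate G {a}" using maxE[OF A] by blast
    obtain b where b: "b \<in> carrier G" "B = generate G {b}" using maxE[OF B] by blast
    have AB: "A \<subseteq> carrier G" "B \<subseteq> carrier G" using a b sub by auto
    then have fAB: "f ` A \<subseteq> carrier Q" "f ` B \<subseteq> carrier Q" using surj by blast+
    have "(\<exists>z\<in>carrier G. B = conjugate G z A)
      \<longleftrightarrow> (\<exists>w\<in>carrier Q. f ` B = conjugate Q w (f ` A))"
    proof
      assume "\<exists>z\<in>carrier G. B = conjugate G z A"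
      then show "\<exists>w\<in>carrier Q. f ` B = conjugate Q w (f ` A)"
        using equivar AB(1) hom_closed by metis
    next
      assume "\<exists>w\<in>carrier Q. f ` B = conjugate Q w (f ` A)"
      then obtain v where "v \<in> carrier Q" "f ` B = conjugate Q v (f ` A)" by blast
      moreover from this obtain z where "z \<in> carrier G" "v = f z" using surj by (metis imageE)
      ultimately have z: "z \<in> carrier G" "f ` B = conjugate Q (f z) (f ` A)" by simp_all
      let ?c = "z \<otimes>\<^bsub>G\<^esub> a \<otimes>\<^bsub>G\<^esub> inv\<^bsub>G\<^esub> z"
      have c: "?c \<in> carrier G" "generate G {?c} = conjugate G z A"
        using G.conjugate_generate z(1) a by auto
      have "f ` B = f ` generate G {?c}" using equivar[OF z(1) AB(1)] z(2) c(2) by simp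
      then obtain w where w: "w \<in> carrier G" "generate G {?c} = conjugate G w B"
        using key[OF b(1) _ c(1)] B b(2) by auto
      have "B = conjugate G (inv\<^bsub>G\<^esub> w) (conjugate G z A)"
        using G.conjugate_inverse[OF w(1) AB(2)] w(2) c(2) by simp
      then have "B = conjugate G (inv\<^bsub>G\<^esub> w \<otimes>\<^bsub>G\<^esub> z) A"
        using G.conjugate_conjugate[OF _ z(1) AB(1), of "inv\<^bsub>G\<^esub> w"] w(1) by simp
      moreover have "inv\<^bsub>G\<^esub> w \<otimes>\<^bsub>G\<^esub> z \<in> carrier G" using w(1) z(1) by simp
      ultimately show "\<exists>z\<in>carrier G. B = conjugate G z A" by blast
    qed
    then show ?thesis
      using G.orbit_conjugate_eq_iff[OF AB] H.orbit_conjugate_eq_iff[OF fAB] by simp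
  qed
  show ?thesis
    unfolding eta_eq_card_orbits
    by (rule card_image_eq_via[where F = "(`) f"]) (fact orbits_iff, fact onto)
qed

section \<open>Congruences modulo powers of two\<close>

text \<open>
  Multiplication by \<open>2\<^sup>s u\<close> reaches every multiple of \<open>2\<^sup>s\<close> modulo \<open>2\<^sup>n\<close>, because the odd factor is
  invertible. The solution is a natural number so that it can serve as an exponent.
\<close>

lemma solve_two_power_congruence:
  fixes u c :: int
  assumes "odd u" "s \<le> t"
  shows "\<exists>k::nat. [int k * (2 ^ s * u) = 2 ^ t * c] (mod 2 ^ n)"
proof -
  have "coprime u (2 ^ n)" using assms(1) by simp
  then obtain v where v: "[u * v = 1] (mod 2 ^ n)" using cong_solve_coprime_int by blast
  define w where "w = v * 2 ^ (t - s) * c"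
  have "[w * (2 ^ s * u) = (u * v) * (2 ^ t * c)] (mod 2 ^ n)"
    using assms(2) by (simp add: w_def power_diff_power_eq algebra_simps flip: power_add)
  also have "[(u * v) * (2 ^ t * c) = 1 * (2 ^ t * c)] (mod 2 ^ n)"
    by (intro cong_mult v cong_refl)
  finally have "[w * (2 ^ s * u) = 2 ^ t * c] (mod 2 ^ n)" by simp
  moreover have "[int (nat (w mod 2 ^ n)) = w] (mod 2 ^ n)" by simp
  then have "[int (nat (w mod 2 ^ n)) * (2 ^ s * u) = w * (2 ^ s * u)] (mod 2 ^ n)"
    by (rule cong_mult) (rule cong_refl)
  ultimately show ?thesis using cong_trans by blast
qed

lemma odd_power_one_plus:
  fixes u :: int
  assumes "odd u" "1 \<le> t" "odd k"
  shows "\<exists>w. odd w \<and> (1 + 2 ^ t * u) ^ k = 1 + 2 ^ t * w"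
proof -
  obtain c where k: "k = 2 * c + 1" using assms(3) oddE by blast
  show ?thesis unfolding k
  proof (induction c)
    case 0
    show ?case using assms(1) by auto
  next
    case (Suc c)
    then obtain w where w: "odd w" "(1 + 2 ^ t * u) ^ (2 * c + 1) = 1 + 2 ^ t * w" by blast
    obtain s where t: "t = Suc s" using assms(2) by (cases t) auto
    let ?w = "w + (1 + 2 ^ t * w) * (2 * u + 2 ^ t * u ^ 2)"
    have "(1 + 2 ^ t * u) ^ (2 * Suc c + 1) = (1 + 2 ^ t * u) ^ (2 * c + 1) * (1 + 2 ^ t * u) ^ 2"
      by (simp flip: power_add)
    also have "\<dots> = 1 + 2 ^ t * ?w"
      unfolding w(2) by (simp add: power2_eq_square algebra_simps)
    finally show ?case using w(1) t by (intro exI[of _ ?w]) auto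
  qed
qed

lemma two_power_power_one_plus:
  fixes u :: int
  assumes "odd u" "2 \<le> t"
  shows "\<exists>w. odd w \<and> (1 + 2 ^ t * u) ^ (2 ^ k) = 1 + 2 ^ (t + k) * w"
proof (induction k)
  case 0
  show ?case using assms(1) by auto
next
  case (Suc k)
  then obtain w where w: "odd w" "(1 + 2 ^ t * u) ^ (2 ^ k) = 1 + 2 ^ (t + k) * w" by blast
  obtain s where t: "t + k = Suc (Suc s)" using assms(2) that[of "t + k - 2"] by simp
  have "(1 + 2 ^ t * u) ^ (2 ^ Suc k) = (1 + 2 ^ (t + k) * w) ^ 2"
    unfolding w(2)[symmetric] by (simp only: power_Suc2 power_mult)
  also have "\<dots> = 1 + 2 ^ (t + Suc k) * (w + 2 ^ Suc s * w ^ 2)"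
    unfolding add_Suc_right t by (simp add: power2_eq_square algebra_simps)
  finally show ?case using w(1) by (intro exI[of _ "w + 2 ^ Suc s * w ^ 2"]) auto
qed

text \<open>
  Since \<open>a\<close> is odd, this says that \<open>1 + 2\<^sup>t u\<close> generates the group of residues congruent to \<open>1\<close>
  modulo \<open>2\<^sup>t\<close>, where residues are taken modulo \<open>2\<^sup>n\<close>. The exponent is corrected one binary digit at a time: a factor
  \<open>(1 + 2\<^sup>t u)\<close> to the power \<open>2\<^bsup>n-t\<^esup>\<close> leaves an odd number unchanged
  modulo \<open>2\<^sup>n\<close> and flips its digit of weight \<open>2\<^sup>n\<close>.
\<close>

lemma powers_cover_coset:
  fixes u a j :: int
  assumes "odd u" "2 \<le> t" "odd a"
  shows "\<exists>i. [a * (1 + 2 ^ t * u) ^ i = a + 2 ^ t * j] (mod 2 ^ n)"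
proof (induction n)
  case 0
  show ?case by simp
next
  case (Suc n)
  then obtain i where i: "[a * (1 + 2 ^ t * u) ^ i = a + 2 ^ t * j] (mod 2 ^ n)" by blast
  show ?case
  proof (cases "n < t")
    case True
    then have "(2::int) ^ Suc n dvd 2 ^ t * j"
      by (intro dvd_mult2 le_imp_power_dvd) simp
    then have "[a = a + 2 ^ t * j] (mod 2 ^ Suc n)"
      by (simp add: cong_iff_dvd_diff del: power_Suc)
    then show ?thesis by (intro exI[of _ 0]) simp
  next
    case False
    obtain c where c: "a * (1 + 2 ^ t * u) ^ i = a + 2 ^ t * j + 2 ^ n * c"
      using i by (metis cong_iff_lin cong_sym)
    show ?thesis
    proof (cases "even c")
      case True
      then obtain d where "c = 2 * d" by blast
      then show ?thesis
        by (intro exI[of _ i]) (simp add: c cong_iff_dvd_diff)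
    next
      case odd_c: False
      obtain w where w: "odd w" "(1 + 2 ^ t * u) ^ (2 ^ (n - t)) = 1 + 2 ^ n * w"
        using two_power_power_one_plus[OF assms(1,2), of "n - t"] False by auto
      \<comment> \<open>\<open>?e\<close> is the value reached so far, wrong in the digit of weight \<open>2\<^sup>n\<close>.\<close>
      let ?e = "a + 2 ^ t * j + 2 ^ n * c"
      have "odd ?e" using assms(2,3) False by auto
      then have "even (c + ?e * w)" using odd_c w(1) by simp
      then obtain d where d: "c + ?e * w = 2 * d" by blast
      have "a * (1 + 2 ^ t * u) ^ (i + 2 ^ (n - t)) = ?e * (1 + 2 ^ n * w)"
        by (simp add: power_add w(2) flip: c)
      also have "\<dots> = a + 2 ^ t * j + 2 ^ n * (c + ?e * w)"
        by (simp add: algebra_simps)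
      also have "\<dots> = a + 2 ^ t * j + 2 ^ Suc n * d"
        by (simp add: d)
      finally show ?thesis
        by (intro exI[of _ "i + 2 ^ (n - t)"]) (simp add: cong_iff_dvd_diff)
    qed
  qed
qed

section \<open>Metacyclic 2-groups with a negative action\<close>

text \<open>
  Maximality makes \<open>h\<close> a power of its own square, say \<open>h = h\<^bsup>2k\<^esup>\<close>. Iterating this equation \<open>n\<close> times writes \<open>h\<close> as a
  power of \<open>h\<close> to the \<open>2\<^sup>n\<close>, so \<open>h = \<one>\<close>; but the trivial subgroup is maximal cyclic only in the trivial
  group.
\<close>

lemma (in group) trivial_if_square_generates_maximal_cyclic:
  assumes fin: "finite (carrier G)" and h: "h \<in> carrier G" and pow: "h [^] (2 ^ n :: nat) = \<one>"
    and max: "generate G {h \<otimes> h} \<in> maximal_cyclic_subgroups G"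
  shows "carrier G = {\<one>}"
proof -
  have "h \<otimes> h \<in> generate G {h}"
    using generate.eng generate.incl by (metis singletonI)
  then have "generate G {h} = generate G {h \<otimes> h}"
    using maximal_cyclic_eq[OF max cyclic_subgroup_generate[OF h]]
      generate_singleton_subset[OF h] by blast
  then have "h \<in> generate G {h \<otimes> h}"
    using generate.incl[of h "{h}" G] by simp
  then obtain k :: nat where "h = (h \<otimes> h) [^] k"
    using generate_pow_on_finite_carrier[OF fin, of "h \<otimes> h"] h by auto
  moreover have "h \<otimes> h = h [^] (2::nat)" using h by (simp add: numeral_2_eq_2)
  ultimately have hk: "h [^] (2 * k) = h" using h by (simp add: nat_pow_pow)
  have "h [^] ((2 * k) ^ i) = h" for i
  proof (induction i)
    case (Suc i)
    then show ?case
      using h hk nat_pow_pow[of h "(2 * k) ^ i" "2 * k"] by (simp add: mult.commute)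
  qed (use h in simp)
  from this[of n] have "h = (h [^] (2 ^ n :: nat)) [^] (k ^ n)"
    using h by (simp add: nat_pow_pow power_mult_distrib)
  then have "h = \<one>" using pow by simp
  then have max1: "generate G {\<one>} \<in> maximal_cyclic_subgroups G" using max by simp
  have "c = \<one>" if c: "c \<in> carrier G" for c
  proof -
    have "generate G {c} = generate G {\<one>}"
      using maximal_cyclic_eq[OF max1 cyclic_subgroup_generate[OF c]] generate.one[of G "{c}"]
      by (simp add: generate_one)
    then show ?thesis using generate.incl[of c "{c}" G] by (simp add: generate_one)
  qed
  then show ?thesis by auto
qed

text \<open>
  What is used of the presentation. The numbers \<open>2\<^sup>A\<close> and \<open>2\<^sup>B\<close> are exponents that annihilate \<open>x\<close> and \<open>y\<close>,
  possibly larger than their orders. So the relation between \<open>y\<close> and \<open>x\<close> that depends on \<open>\<epsilon>\<close> enters only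
  through an exponent for \<open>y\<close>, and the representation \<open>y\<^sup>b x\<^sup>a\<close> of an element need not be unique.
\<close>

locale negative_metacyclic_2_group = group G for G (structure) +
  fixes x y and A B m :: nat
  assumes x [simp]: "x \<in> carrier G" and y [simp]: "y \<in> carrier G"
    and x_order: "x [^] (2 ^ A :: nat) = \<one>" and y_order: "y [^] (2 ^ B :: nat) = \<one>"
    and x_y: "x \<otimes> y = y \<otimes> x [^] (2 ^ m - 1 :: nat)"
    and m: "2 \<le> m"
    and generated: "carrier G = generate G {x, y}"
begin

abbreviation "r \<equiv> 2 ^ m - 1 :: nat"

lemma x_pow_y_pow: "x [^] c \<otimes> y [^] b = y [^] b \<otimes> x [^] (c * r ^ b)" for c b :: nat
proof -
  have 1: "x [^] c \<otimes> y = y \<otimes> x [^] (c * r)" for c :: nat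
  proof (induction c)
    case (Suc c)
    have "x [^] Suc c \<otimes> y = x [^] c \<otimes> (x \<otimes> y)" by (simp add: m_assoc)
    also have "\<dots> = (x [^] c \<otimes> y) \<otimes> x [^] r" by (simp add: x_y m_assoc)
    also have "\<dots> = y \<otimes> x [^] (Suc c * r)"
      by (simp add: Suc m_assoc nat_pow_mult add.commute)
    finally show ?case .
  qed simp
  show ?thesis
  proof (induction b)
    case (Suc b)
    have "x [^] c \<otimes> y [^] Suc b = (x [^] c \<otimes> y [^] b) \<otimes> y" by (simp add: m_assoc)
    also have "\<dots> = y [^] b \<otimes> (x [^] (c * r ^ b) \<otimes> y)" by (simp add: Suc m_assoc)
    also have "\<dots> = y [^] Suc b \<otimes> x [^] (c * r ^ Suc b)"
      by (simp only: 1) (simp add: m_assoc mult_ac)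
    finally show ?case .
  qed simp
qed

lemma normal_form_mult:
  "(y [^] b \<otimes> x [^] a) \<otimes> (y [^] d \<otimes> x [^] c) = y [^] (b + d) \<otimes> x [^] (a * r ^ d + c)"
  for a b c d :: nat
proof -
  have "(y [^] b \<otimes> x [^] a) \<otimes> (y [^] d \<otimes> x [^] c) = y [^] b \<otimes> (x [^] a \<otimes> y [^] d) \<otimes> x [^] c"
    by (simp add: m_assoc)
  also have "\<dots> = (y [^] b \<otimes> y [^] d) \<otimes> (x [^] (a * r ^ d) \<otimes> x [^] c)"
    by (simp add: x_pow_y_pow m_assoc)
  finally show ?thesis by (simp add: nat_pow_mult)
qed

lemma normal_form:
  assumes "g \<in> carrier G"
  shows "\<exists>(b::nat) (a::nat). g = y [^] b \<otimes> x [^] a"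
proof -
  have inv_pow: "inv z = z [^] (2 ^ n - 1 :: nat)"
    if "z \<in> carrier G" "z [^] (2 ^ n :: nat) = \<one>" for z and n :: nat
  proof (rule inv_equality)
    show "z [^] (2 ^ n - 1 :: nat) \<otimes> z = \<one>"
      using that nat_pow_Suc[of z "2 ^ n - 1"] by simp
  qed (use that in simp_all)
  have "g \<in> generate G {x, y}" using assms generated by simp
  then show ?thesis
  proof (induction rule: generate.induct)
    case one
    have "\<one> = y [^] (0::nat) \<otimes> x [^] (0::nat)" by simp
    then show ?case by blast
  next
    case (incl g)
    then consider "g = y [^] (0::nat) \<otimes> x [^] (1::nat)" | "g = y [^] (1::nat) \<otimes> x [^] (0::nat)"
      by auto
    then show ?case by cases blast+
  next
    case (inv g)
    then consider "inv g = y [^] (0::nat) \<otimes> x [^] (2 ^ A - 1 :: nat)"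
      | "inv g = y [^] (2 ^ B - 1 :: nat) \<otimes> x [^] (0::nat)"
      using inv_pow[OF x x_order] inv_pow[OF y y_order] by auto
    then show ?case by cases blast+
  next
    case (eng g h)
    then show ?case using normal_form_mult by metis
  qed
qed

lemma x_pow_cong:
  assumes "[int c = int d] (mod 2 ^ A)"
  shows "x [^] c = x [^] d"
proof -
  have red: "x [^] c = x [^] (c mod 2 ^ A)" for c :: nat
  proof -
    have "x [^] c = x [^] (2 ^ A * (c div 2 ^ A) + c mod 2 ^ A)" by simp
    also have "\<dots> = (x [^] (2 ^ A :: nat)) [^] (c div 2 ^ A) \<otimes> x [^] (c mod 2 ^ A)"
      by (simp only: nat_pow_mult[symmetric] nat_pow_pow[symmetric] x nat_pow_closed)
    finally show ?thesis by (simp add: x_order)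
  qed
  have "c mod 2 ^ A = d mod 2 ^ A"
    using assms cong_int_iff[of c d "2 ^ A"] by (simp add: cong_def)
  then show ?thesis using red[of c] red[of d] by simp
qed

lemma y_pow_mod: "y [^] b = y [^] (b mod 2 ^ B)" for b :: nat
proof -
  have "y [^] b = y [^] (2 ^ B * (b div 2 ^ B) + b mod 2 ^ B)" by simp
  also have "\<dots> = (y [^] (2 ^ B :: nat)) [^] (b div 2 ^ B) \<otimes> y [^] (b mod 2 ^ B)"
    by (simp only: nat_pow_mult[symmetric] nat_pow_pow[symmetric] y nat_pow_closed)
  finally show ?thesis by (simp add: y_order)
qed

lemma finite_carrier: "finite (carrier G)"
proof (rule finite_subset)
  show "carrier G \<subseteq> (\<lambda>(b, a). y [^] b \<otimes> x [^] a) ` ({..<2 ^ B :: nat} \<times> {..<2 ^ A :: nat})"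
  proof
    fix g assume "g \<in> carrier G"
    then obtain b a :: nat where "g = y [^] b \<otimes> x [^] a" using normal_form by blast
    moreover have "x [^] a = x [^] (a mod 2 ^ A)" by (rule x_pow_cong) (simp add: cong_def zmod_int)
    ultimately have "g = y [^] (b mod 2 ^ B) \<otimes> x [^] (a mod 2 ^ A)" using y_pow_mod by metis
    then show "g \<in> (\<lambda>(b, a). y [^] b \<otimes> x [^] a) ` ({..<2 ^ B :: nat} \<times> {..<2 ^ A :: nat})"
      by (intro image_eqI[of _ _ "(b mod 2 ^ B, a mod 2 ^ A)"]) auto
  qed
qed simp

lemma exponent_two_power:
  assumes "g \<in> carrier G"
  shows "g [^] (2 ^ (B + A) :: nat) = \<one>"
proof -
  obtain b a :: nat where g: "g = y [^] b \<otimes> x [^] a" using normal_form assms by blast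
  have "\<exists>e :: nat. g [^] k = y [^] (b * k) \<otimes> x [^] e" for k :: nat
  proof (induction k)
    case 0
    show ?case by (intro exI[of _ 0]) simp
  next
    case (Suc k)
    then obtain e :: nat where "g [^] k = y [^] (b * k) \<otimes> x [^] e" by blast
    then have "g [^] Suc k = y [^] (b * Suc k) \<otimes> x [^] (e * r ^ b + a)"
      using normal_form_mult[of "b * k" e b a] g by (simp add: add.commute)
    then show ?case by blast
  qed
  then obtain e :: nat where "g [^] (2 ^ B :: nat) = y [^] (b * 2 ^ B) \<otimes> x [^] e" by blast
  moreover have "y [^] (b * 2 ^ B) = \<one>" using y_pow_mod[of "b * 2 ^ B"] by simp
  ultimately have "g [^] (2 ^ B :: nat) = x [^] e" by simp
  moreover have "(x [^] e) [^] (2 ^ A :: nat) = \<one>"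
    using nat_pow_pow[of x e "2 ^ A"] nat_pow_pow[of x "2 ^ A" e] x_order
    by (simp add: mult.commute)
  ultimately show ?thesis
    using nat_pow_pow[OF assms, of "2 ^ B" "2 ^ A"] by (simp add: power_add)
qed

text \<open>The odd factor \<open>u\<close> shared by \<open>r = 1 + 2u\<close> and \<open>r\<^sup>2 = 1 + 2\<^bsup>m+1\<^esup> u\<close>.\<close>

definition "odd_part = (2 ^ (m - 1) - 1 :: int)"

lemma odd_odd_part: "odd odd_part"
  using m by (simp add: odd_part_def)

lemma int_r: "int r = 2 ^ m - 1"
  by (simp add: of_nat_diff)

lemma int_r_eq: "int r = 1 + 2 ^ 1 * odd_part"
proof -
  have "m = Suc (m - 1)" using m by simp
  then have "(2::int) ^ m = 2 * 2 ^ (m - 1)" by (metis power_Suc)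
  then show ?thesis unfolding int_r odd_part_def by simp
qed

lemma int_r_square: "int r ^ 2 = 1 + 2 ^ (m + 1) * odd_part"
proof -
  have "m = Suc (m - 1)" using m by simp
  then have "(2::int) ^ m = 2 * 2 ^ (m - 1)" by (metis power_Suc)
  then show ?thesis unfolding int_r_eq odd_part_def by (simp add: power2_eq_square algebra_simps)
qed

text \<open>
  Odd powers do not change the 2-part of \<open>r - 1\<close> or of \<open>r\<^sup>2 - 1\<close>. So for odd \<open>b\<close> the 2-part of
  \<open>1 - r\<^sup>b\<close> is \<open>2\<close>, and for \<open>b\<close> twice an odd number it is \<open>2\<^bsup>m+1\<^esup>\<close>.
\<close>

lemma one_minus_r_power:
  fixes b :: nat
  assumes "\<not> 4 dvd b"
  shows "\<exists>s u. odd u \<and> s \<le> m + 1 \<and> 1 - int r ^ b = 2 ^ s * u"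
proof (cases "odd b")
  case True
  then obtain w where w: "odd w" "int r ^ b = 1 + 2 ^ 1 * w"
    using odd_power_one_plus[OF odd_odd_part _ True, of 1] unfolding int_r_eq by auto
  then show ?thesis by (intro exI[of _ 1] exI[of _ "- w"]) simp
next
  case False
  then obtain c where c: "b = 2 * c" by blast
  then have "odd c" using assms by auto
  then obtain w where w: "odd w" "int r ^ b = 1 + 2 ^ (m + 1) * w"
    using odd_power_one_plus[OF odd_odd_part, of "m + 1" c] int_r_square
    unfolding c power_mult by auto
  then show ?thesis by (intro exI[of _ "m + 1"] exI[of _ "- w"]) simp
qed

text \<open>
  Moving \<open>x\<^sup>k\<close> past \<open>y\<^sup>b\<close> turns \<open>k\<close> into \<open>k r\<^sup>b\<close>, so the equation asks for
  \<open>k (1 - r\<^sup>b) \<equiv> 2\<^bsup>m+1\<^esup> j\<close> modulo \<open>2\<^sup>A\<close>.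
\<close>

lemma conjugate_by_x:
  fixes a b j :: nat
  assumes "\<not> 4 dvd b"
  shows "\<exists>k :: nat. (y [^] b \<otimes> x [^] a) \<otimes> x [^] k = x [^] k \<otimes> (y [^] b \<otimes> x [^] (a + 2 ^ (m + 1) * j))"
proof -
  obtain s u where su: "odd u" "s \<le> m + 1" "1 - int r ^ b = 2 ^ s * u"
    using one_minus_r_power[OF assms] by blast
  obtain k :: nat where k: "[int k * (2 ^ s * u) = 2 ^ (m + 1) * int j] (mod 2 ^ A)"
    using solve_two_power_congruence[OF su(1,2)] by blast
  have "[int (a + k) = int (k * r ^ b + (a + 2 ^ (m + 1) * j))] (mod 2 ^ A)"
    using k unfolding su(3)[symmetric] cong_iff_dvd_diff
    by (simp only: of_nat_add of_nat_mult of_nat_power) (simp add: algebra_simps del: of_nat_diff)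
  then have "x [^] (a + k) = x [^] (k * r ^ b + (a + 2 ^ (m + 1) * j))" by (rule x_pow_cong)
  then show ?thesis
    using normal_form_mult[of 0 k b "a + 2 ^ (m + 1) * j"]
    by (intro exI[of _ k]) (simp add: m_assoc nat_pow_mult)
qed

text \<open>
  Moving \<open>x\<^sup>a\<close> past \<open>y\<^sup>i\<close> turns \<open>a\<close> into \<open>a r\<^sup>i\<close>. An even \<open>i\<close> suffices, because the powers of \<open>r\<^sup>2\<close> times an odd
  \<open>a\<close> fill the residue class of \<open>a\<close> modulo \<open>2\<^bsup>m+1\<^esup>\<close>.
\<close>

lemma conjugate_by_y:
  fixes a b j :: nat
  assumes "odd a"
  shows "\<exists>i :: nat. (y [^] b \<otimes> x [^] a) \<otimes> y [^] i = y [^] i \<otimes> (y [^] b \<otimes> x [^] (a + 2 ^ (m + 1) * j))"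
proof -
  have "odd (int a)" using assms by simp
  then obtain i where "[int a * (int r ^ 2) ^ i = int a + 2 ^ (m + 1) * int j] (mod 2 ^ A)"
    using powers_cover_coset[OF odd_odd_part, of "m + 1" "int a" "int j" A] m
    unfolding int_r_square by auto
  then have "[int (a * r ^ (2 * i)) = int (a + 2 ^ (m + 1) * j)] (mod 2 ^ A)"
    by (simp add: power_mult)
  then have "x [^] (a * r ^ (2 * i)) = x [^] (a + 2 ^ (m + 1) * j)" by (rule x_pow_cong)
  then show ?thesis
    using normal_form_mult[of b a "2 * i" 0] nat_pow_mult[of y "2 * i" b]
    by (intro exI[of _ "2 * i"]) (simp add: m_assoc[symmetric] add.commute)
qed

text \<open>
  The square of \<open>y\<^bsup>2c\<^esup> x\<^sup>k\<close> is \<open>y\<^bsup>4c\<^esup>\<close> times \<open>x\<close> to the power \<open>k (r\<^bsup>2c\<^esup> + 1)\<close>. As \<open>r\<^bsup>2c\<^esup>\<close> is an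
  odd square, the second factor is twice an odd number, so that \<open>k\<close> can be chosen to give any even exponent.
\<close>

lemma square_if_four_dvd_even:
  fixes a b :: nat
  assumes "4 dvd b" "even a"
  shows "\<exists>h\<in>carrier G. y [^] b \<otimes> x [^] a = h \<otimes> h"
proof -
  obtain c where c: "b = 4 * c" using assms(1) by blast
  obtain a' where a': "a = 2 * a'" using assms(2) by blast
  have "odd (int r ^ c)" using m by (simp add: int_r)
  then obtain d where d: "int r ^ c = 2 * d + 1" using oddE by blast
  define u where "u = 2 * d ^ 2 + 2 * d + 1"
  have u: "int r ^ (2 * c) + 1 = 2 ^ 1 * u"
    unfolding u_def mult.commute[of 2 c] power_mult d by (simp add: power2_eq_square algebra_simps)
  have "odd u" by (simp add: u_def)
  then obtain k :: nat where k: "[int k * (2 ^ 1 * u) = 2 ^ 1 * int a'] (mod 2 ^ A)"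
    using solve_two_power_congruence[of u 1 1] by blast
  have "[int (k * r ^ (2 * c) + k) = int a] (mod 2 ^ A)"
    using k unfolding u[symmetric] a'
    by (simp only: of_nat_add of_nat_mult of_nat_power) (simp add: algebra_simps del: of_nat_diff)
  then have "x [^] (k * r ^ (2 * c) + k) = x [^] a" by (rule x_pow_cong)
  then have "y [^] b \<otimes> x [^] a = (y [^] (2 * c) \<otimes> x [^] k) \<otimes> (y [^] (2 * c) \<otimes> x [^] k)"
    unfolding normal_form_mult by (simp add: c)
  then show ?thesis by (intro bexI[of _ "y [^] (2 * c) \<otimes> x [^] k"]) simp_all
qed

abbreviation "N \<equiv> generate G {x [^] (2 ^ (m + 1) :: nat)}"

lemma N_eq: "N = {x [^] (2 ^ (m + 1) * j) |j. j \<in> (UNIV :: nat set)}"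
  using generate_pow_on_finite_carrier[OF finite_carrier, of "x [^] (2 ^ (m + 1) :: nat)"]
  by (simp add: nat_pow_pow)

lemma normal_N: "N \<lhd> G"
  unfolding normal_inv_iff
proof (intro conjI ballI)
  show "subgroup N G" by (rule generate_is_subgroup) simp
  fix g n assume g: "g \<in> carrier G" and "n \<in> N"
  then obtain j :: nat where n: "n = x [^] (2 ^ (m + 1) * j)" unfolding N_eq by blast
  obtain b a :: nat where inv_g: "inv g = y [^] b \<otimes> x [^] a" using normal_form g by blast
  have "n \<otimes> inv g = y [^] b \<otimes> x [^] (2 ^ (m + 1) * j * r ^ b + a)"
    using normal_form_mult[of 0 "2 ^ (m + 1) * j" b a] by (simp add: n inv_g)
  also have "\<dots> = inv g \<otimes> x [^] (2 ^ (m + 1) * (j * r ^ b))"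
    by (simp add: inv_g m_assoc nat_pow_mult mult.assoc add.commute)
  finally have "g \<otimes> (n \<otimes> inv g) = g \<otimes> (inv g \<otimes> x [^] (2 ^ (m + 1) * (j * r ^ b)))" by simp
  also have "\<dots> = x [^] (2 ^ (m + 1) * (j * r ^ b))" using g by (simp add: m_assoc[symmetric])
  finally have "g \<otimes> n \<otimes> inv g = x [^] (2 ^ (m + 1) * (j * r ^ b))" using g n by (simp add: m_assoc)
  then show "g \<otimes> n \<otimes> inv g \<in> N" unfolding N_eq by blast
qed

lemma coset_conjugate_if_maximal_cyclic:
  assumes g: "g \<in> carrier G" and max: "generate G {g} \<in> maximal_cyclic_subgroups G"
    and h: "h \<in> carrier G" and coset: "N #> h = N #> g"
  shows "\<exists>z\<in>carrier G. h = z \<otimes> g \<otimes> inv z"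
proof -
  obtain b a :: nat where ba: "g = y [^] b \<otimes> x [^] a" using normal_form g by blast
  have "h \<in> N #> g"
    using rcos_self[OF h normal_imp_subgroup[OF normal_N]] coset by simp
  then have "h \<in> g <# N" using normal.coset_eq[OF normal_N] g by simp
  then obtain j :: nat where "h = g \<otimes> x [^] (2 ^ (m + 1) * j)"
    unfolding l_coset_def N_eq by blast
  then have hj: "h = y [^] b \<otimes> x [^] (a + 2 ^ (m + 1) * j)"
    by (simp add: ba m_assoc nat_pow_mult)
  have conj: ?thesis if "z \<in> carrier G" "g \<otimes> z = z \<otimes> h" for z
  proof
    show "inv z \<in> carrier G" using that(1) by simp
    have "h = inv z \<otimes> (z \<otimes> h)" using that(1) h by (simp add: m_assoc[symmetric])
    then show "h = inv z \<otimes> g \<otimes> inv (inv z)" using that g by (simp add: m_assoc)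
  qed
  consider "\<not> 4 dvd b" | "odd a" | "4 dvd b" "even a" by blast
  then show ?thesis
  proof cases
    case 1
    then obtain k :: nat where "g \<otimes> x [^] k = x [^] k \<otimes> h"
      using conjugate_by_x unfolding ba hj by blast
    then show ?thesis using conj[of "x [^] k"] by simp
  next
    case 2
    then obtain i :: nat where "g \<otimes> y [^] i = y [^] i \<otimes> h"
      using conjugate_by_y unfolding ba hj by blast
    then show ?thesis using conj[of "y [^] i"] by simp
  next
    case 3
    then obtain k where "k \<in> carrier G" "g = k \<otimes> k"
      using square_if_four_dvd_even unfolding ba by blast
    then have "carrier G = {\<one>}"
      using trivial_if_square_generates_maximal_cyclic finite_carrier exponent_two_power max by blast
    then show ?thesis using g h by (intro bexI[of _ \<one>]) auto
  qed
qed

theorem eta_Mod_N: "eta G = eta (G Mod N)"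
proof (rule eta_eq_if_fibres_conjugate)
  show "group_hom G (G Mod N) (\<lambda>g. N #> g)"
    by (intro group_hom.intro group_hom_axioms.intro is_group
        normal.factorgroup_is_group[OF normal_N] normal.r_coset_hom_Mod[OF normal_N])
  show "(\<lambda>g. N #> g) ` carrier G = carrier (G Mod N)"
    by (auto simp: FactGroup_def RCOSETS_def)
qed (use finite_carrier coset_conjugate_if_maximal_cyclic in auto)

end

section \<open>Reading off the presentation\<close>

text \<open>
  The exponent \<open>2\<^bsup>\<beta>+1\<^esup>\<close> annihilates \<open>y\<close> for both values of \<open>\<epsilon>\<close>, because the \<open>2\<^sup>\<beta>\<close>-th power of
  \<open>y\<close> is a power of \<open>x\<close> of order at most \<open>2\<close>.
\<close>

lemma is_G2_neg_imp_metacyclic: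
  fixes G (structure)
  assumes "is_G2_neg G x y \<alpha> \<beta> \<epsilon> \<delta>" and "2 \<le> \<alpha> - \<delta>" and "\<epsilon> \<in> {0, 1}" and "\<delta> + \<epsilon> \<le> \<alpha>"
  shows "negative_metacyclic_2_group G x y \<alpha> (\<beta> + 1) (\<alpha> - \<delta>)"
proof -
  let ?R = "G2_neg_relations \<alpha> \<beta> \<epsilon> \<delta>"
  let ?P = "presented_group ?R"
  obtain h where G: "group G" and h: "h \<in> iso ?P G"
      and hx: "h (word_class ?R [(gen_x, True)]) = x" and hy: "h (word_class ?R [(gen_y, True)]) = y"
    using assms(1) unfolding is_G2_neg_def G2_neg_def by blast
  interpret group G by (rule G)
  interpret h: group_hom ?P G h
    using h G group_presented_group
    by (intro group_hom.intro group_hom_axioms.intro) (auto simp: iso_def)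
  \<comment> \<open>The evaluation of words in \<open>G\<close>: it respects the relations and concatenation.\<close>
  define \<phi> where "\<phi> u = h (word_class ?R u)" for u
  have in_P: "word_class ?R u \<in> carrier ?P" for u by (simp add: presented_group_def)
  have carr [simp]: "\<phi> u \<in> carrier G" for u using in_P by (simp add: \<phi>_def)
  have app: "\<phi> (u @ v) = \<phi> u \<otimes> \<phi> v" for u v
    unfolding \<phi>_def presented_group_mult[symmetric] using in_P by simp
  have nil: "\<phi> [] = \<one>" using h.hom_one by (simp add: \<phi>_def presented_group_def)
  have eq: "\<phi> u = \<phi> v" if "pres_eq ?R u v" for u v
    using that word_class_eq_iff unfolding \<phi>_def by metis
  have x: "\<phi> [(gen_x, True)] = x" and y: "\<phi> [(gen_y, True)] = y" using hx hy by (simp_all add: \<phi>_def)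
  then have xy [simp]: "x \<in> carrier G" "y \<in> carrier G" using carr by metis+
  have pow: "\<phi> (gen_pow g n) = \<phi> [(g, True)] [^] n" for g n
  proof (induction n)
    case (Suc n)
    have "gen_pow g (Suc n) = gen_pow g n @ [(g, True)]" by (simp add: replicate_append_same)
    then show ?case using Suc by (simp only: app nat_pow_Suc)
  qed (simp add: nil)
  have inverse: "\<phi> [(g, False)] = inv \<phi> [(g, True)]" for g
  proof (rule inv_equality[symmetric])
    show "\<phi> [(g, False)] \<otimes> \<phi> [(g, True)] = \<one>"
      using eq[OF pres_eq.cancel[of ?R g False]] by (simp add: nil flip: app)
  qed simp_all
  have x_order: "x [^] (2 ^ \<alpha> :: nat) = \<one>"
    using eq[OF pres_eq.relation, of "gen_pow gen_x (2 ^ \<alpha>)" "[]"]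
    by (simp add: G2_neg_relations_def pow nil x)
  have y_pow: "y [^] (2 ^ \<beta> :: nat) = x [^] (2 ^ (\<alpha> - \<epsilon>) :: nat)"
    using eq[OF pres_eq.relation, of "gen_pow gen_y (2 ^ \<beta>)" "gen_pow gen_x (2 ^ (\<alpha> - \<epsilon>))"]
    by (simp add: G2_neg_relations_def pow x y)
  have y_order: "y [^] (2 ^ (\<beta> + 1) :: nat) = \<one>"
  proof -
    have "y [^] (2 ^ (\<beta> + 1) :: nat) = (y [^] (2 ^ \<beta> :: nat)) [^] (2 :: nat)"
      by (simp add: nat_pow_pow mult.commute)
    also have "\<dots> = x [^] (2 ^ (\<alpha> - \<epsilon>) * 2 :: nat)" by (simp add: y_pow nat_pow_pow)
    also have "(2 ^ (\<alpha> - \<epsilon>) * 2 :: nat) = 2 ^ \<alpha> * 2 ^ (1 - \<epsilon>)"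
    proof -
      have "Suc (\<alpha> - \<epsilon>) = \<alpha> + (1 - \<epsilon>)" using assms(3,4) by auto
      then show ?thesis by (metis power_Suc2 power_add)
    qed
    also have "x [^] \<dots> = (x [^] (2 ^ \<alpha> :: nat)) [^] (2 ^ (1 - \<epsilon>) :: nat)"
      by (simp add: nat_pow_pow)
    finally show ?thesis by (simp add: x_order)
  qed
  have "inv y \<otimes> x \<otimes> y = x [^] (2 ^ (\<alpha> - \<delta>) - 1 :: nat)"
  proof -
    have "\<phi> ([(gen_y, False)] @ [(gen_x, True)] @ [(gen_y, True)]) = \<phi> (gen_pow gen_x (2 ^ (\<alpha> - \<delta>) - 1))"
      by (rule eq[OF pres_eq.relation]) (simp add: G2_neg_relations_def)
    then show ?thesis unfolding app pow inverse x y by (simp add: m_assoc)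
  qed
  then have "y \<otimes> (inv y \<otimes> x \<otimes> y) = y \<otimes> x [^] (2 ^ (\<alpha> - \<delta>) - 1 :: nat)" by simp
  moreover have "y \<otimes> (inv y \<otimes> x \<otimes> y) = x \<otimes> y" by (simp add: m_assoc[symmetric])
  ultimately have x_y: "x \<otimes> y = y \<otimes> x [^] (2 ^ (\<alpha> - \<delta>) - 1 :: nat)" by simp
  have "\<phi> u \<in> generate G {x, y}" for u
  proof (induction u)
    case Nil
    show ?case by (simp add: nil generate.one)
  next
    case (Cons l u)
    obtain g b where l: "l = (g, b)" by fastforce
    have "\<phi> [(g, True)] \<in> {x, y}" using x y by (cases g) simp_all
    then have "\<phi> [l] \<in> generate G {x, y}"
      using generate.incl[of _ "{x, y}" G] generate.inv[of _ "{x, y}" G] inverse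
      by (cases b) (simp_all add: l)
    then show ?case using app[of "[l]" u] Cons generate.eng by fastforce
  qed
  moreover have "carrier G = range \<phi>"
    using h by (auto simp: \<phi>_def iso_def bij_betw_def presented_group_def)
  ultimately have "carrier G \<subseteq> generate G {x, y}" by auto
  then have generated: "carrier G = generate G {x, y}"
    using generate_incl[of "{x, y}"] by simp
  show ?thesis
    by unfold_locales (fact xy x_order y_order x_y assms(2) generated)+
qed

theorem theorem4p1:
  fixes G :: "('a, 'b) monoid_scheme" and N :: "'a set" and x y :: 'a and \<alpha> \<beta> \<epsilon> \<delta> :: nat
  assumes "0 < \<alpha>" and "0 < \<beta>" and "\<epsilon> \<in> {0, 1}"
    and "\<delta> \<le> \<beta>" and "2 \<le> \<alpha> - \<delta>" and "\<delta> + \<epsilon> \<le> \<alpha>"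
    and "is_G2_neg G x y \<alpha> \<beta> \<epsilon> \<delta>"
    and "1 \<le> \<delta>"
    and "N = generate G {x [^]\<^bsub>G\<^esub> ((2::nat) ^ (\<alpha> - \<delta> + 1))}"
  shows "eta G = eta (G Mod N)"
proof -
  interpret M: negative_metacyclic_2_group G x y \<alpha> "\<beta> + 1" "\<alpha> - \<delta>"
    using is_G2_neg_imp_metacyclic[OF assms(7,5,3,6)] .
  show ?thesis using M.eta_Mod_N assms(9) by simp
qed

end
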